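(* Let $\beta,n\ge 2$ be integers, let $x_0=0$, $x_n=1$, let $0<x_1<\cdots<x_{n-1}<1$ be real numbers each of which is rational or belongs to $S'_{\beta,n}$, and let $\alpha_1,\alpha_2,\ldots,\alpha_n$ be elements of $\{1,2,\ldots,\beta\}$ with $\alpha_1\neq\beta$. Let $f:[0,1)\to[0,1)$ be the map defined by $$f(x)=-\frac1\beta x+\frac{\alpha_i}{\beta}\quad\text{for all } x\in[x_{i-1},x_i)\text{ and } 1\le i\le n.$$ Then the global attractor $\omega(f)$ of $f$ is finite.
   Context: Let $I=[0,1)$. For a map $f:I\to I$, the $\omega$-limit set (global attractor) of $f$ is $$\omega(f)=\bigcup_{x\in I}\omega(x,f),\qquad \omega(x,f)=\bigcap_{r\ge 0}\overline{\bigcup_{k\ge r}\{f^k(x)\}},$$ where $f^k$ is the $k$-th iterate of $f$ and closures are taken in $[0,1]$. For an infinite word $w=w_0w_1w_2\ldots$ over a finite alphabet and a positive integer $k$, let $L_k(w)=\{w_iw_{i+1}\ldots w_{i+k-1}: i\ge 0\}$ be the set of factors of $w$ of length $k$, and let $p_w(k)=\#L_k(w)$ be its cardinality. For integers $\beta,n\ge 2$ and $w\in\{0,1,\ldots,\beta^2-1\}^{\mathbb{N}}$, let $\varphi(w)=\sum_{i=0}^\infty w_i(\beta^2)^{-(i+1)}\in[0,1]$ be the real number with $\beta^2$-ary expansion $w$. Let $$\ell'=\min\{k\in\mathbb{N}: 2\beta^{-2k}<(1-\beta^{-1})/(n+1)\}$$ and $$S'_{\beta,n}=\{\varphi(w):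 w\in\{0,1,\ldots,\beta^2-1\}^{\mathbb{N}}\text{ and } p_w(\ell')=\beta^{2\ell'}\}.$$ *)

theory Defs
  imports "HOL-Analysis.Analysis"
begin

definition omega_point :: "('a::topological_space \<Rightarrow> 'a) \<Rightarrow> 'a \<Rightarrow> 'a set" where
  "omega_point f x = (\<Inter>r::nat. closure (\<Union>k\<in>{r..}. {(f ^^ k) x}))"

(* A self-map of I = [0,1) is represented by a function on all reals; only its values on I
   matter here. Closures in [0,1] of subsets of [0,1] are closures in the reals. *)
definition global_attractor :: "(real \<Rightarrow> real) \<Rightarrow> real set" where
  "global_attractor f = (\<Union>x\<in>{0..<1}. omega_point f x)"

definition factors :: "nat \<Rightarrow> (nat \<Rightarrow> 'a) \<Rightarrow> 'a list set" where
  "factors k w = {map w [i..<i + k] | i. True}"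

definition complexity :: "(nat \<Rightarrow> 'a) \<Rightarrow> nat \<Rightarrow> nat" where
  "complexity w k = card (factors k w)"

definition words :: "nat \<Rightarrow> (nat \<Rightarrow> nat) set" where
  "words m = {w. \<forall>i. w i \<in> {0..<m}}"

definition expansion_value :: "nat \<Rightarrow> (nat \<Rightarrow> nat) \<Rightarrow> real" where
  "expansion_value b w = (\<Sum>i. real (w i) / real b ^ (i + 1))"

(* For beta, n >= 2 the minimum exists, and it is positive whether or not 0 counts as a
   natural number: the inequality fails at k = 0. *)
definition ell' :: "nat \<Rightarrow> nat \<Rightarrow> nat" where
  "ell' \<beta> n = (LEAST k::nat. 2 / real \<beta> ^ (2 * k) < (1 - 1 / real \<beta>) / real (n + 1))"

definition S' :: "nat \<Rightarrow> nat \<Rightarrow> real set" where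
  "S' \<beta> n = {expansion_value (\<beta>\<^sup>2) w | w.
     w \<in> words (\<beta>\<^sup>2) \<and> complexity w (ell' \<beta> n) = \<beta> ^ (2 * ell' \<beta> n)}"

end

theory Submission imports Defs
begin

text \<open>
  Since \<open>\<beta> f(y) + y\<close> is always an integer, \<open>f\<close> is a right inverse of \<open>y \<mapsto> -\<beta>y mod 1\<close>: a point has at most one
  preimage under each iterate \<open>f^k\<close>, namely the fractional part of \<open>(-\<beta>)^k\<close> times the point. Hence the backward
  orbit of a rational breakpoint is finite because denominators are bounded. The image of \<open>f\<close> is contained
  in \<open>n\<close> intervals of total length \<open>1/\<beta>\<close>, so by the choice of \<open>\<ell>'\<close> it misses a whole \<open>\<beta>\<^sup>2\<close>-adic interval
  of level \<open>\<ell>'\<close>; the expansion of a breakpoint in \<open>S'\<close> visits that interval, which stops its backward orbit.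
  Let \<open>Q\<close> be the finite union of these backward orbits. Two points not separated by \<open>Q\<close> have images not
  separated by \<open>Q\<close> and \<open>\<beta>\<close> times closer, so their orbits are asymptotic. There are only finitely many classes, so
  there are finitely many limit sets, and every orbit visits some class twice and is asymptotically periodic.
\<close>

section \<open>Limit sets of asymptotic and asymptotically periodic orbits\<close>

lemma omega_point_iff:
  fixes f :: "'a::metric_space \<Rightarrow> 'a"
  shows "z \<in> omega_point f x \<longleftrightarrow> (\<forall>r. \<forall>e>0. \<exists>k\<ge>r. dist ((f ^^ k) x) z < e)"
  by (auto simp: omega_point_def closure_approachable)

lemma omega_point_subset_if_asymptotic:
  fixes f :: "'a::metric_space \<Rightarrow> 'a"
  assumes "(\<lambda>k. dist ((f ^^ k) x) ((f ^^ k) y)) \<longlonglongrightarrow> 0"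
  shows "omega_point f x \<subseteq> omega_point f y"
proof
  fix z assume z: "z \<in> omega_point f x"
  show "z \<in> omega_point f y"
    unfolding omega_point_iff
  proof (intro allI impI)
    fix r :: nat and e :: real
    assume "e > 0"
    then have "\<forall>\<^sub>F k in sequentially. dist ((f ^^ k) x) ((f ^^ k) y) < e / 2"
      using order_tendstoD(2)[OF assms, of "e / 2"] by simp
    then obtain N where N: "\<And>k. k \<ge> N \<Longrightarrow> dist ((f ^^ k) x) ((f ^^ k) y) < e / 2"
      unfolding eventually_sequentially by blast
    obtain k where k: "k \<ge> max r N" "dist ((f ^^ k) x) z < e / 2"
      using z \<open>e > 0\<close> unfolding omega_point_iff by (meson half_gt_zero)
    then have "dist ((f ^^ k) y) z < e"
      using N[of k] dist_triangle3[of "(f ^^ k) y" z "(f ^^ k) x"] by simp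
    then show "\<exists>k\<ge>r. dist ((f ^^ k) y) z < e"
      using k by auto
  qed
qed

lemma convergent_if_geometric_increments:
  fixes s :: "nat \<Rightarrow> 'a::banach"
  assumes "0 \<le> \<mu>" "\<mu> < 1" "\<And>j. dist (s (Suc j)) (s j) \<le> C * \<mu> ^ j"
  shows "convergent s"
proof -
  have "summable (\<lambda>j. s (Suc j) - s j)"
  proof (rule summable_comparison_test')
    show "summable (\<lambda>j. C * \<mu> ^ j)"
      using assms by (intro summable_mult summable_geometric) auto
  qed (use assms in \<open>simp add: dist_norm\<close>)
  then have "convergent (\<lambda>m. s m - s 0)"
    by (simp add: summable_iff_convergent sum_lessThan_telescope)
  then have "convergent (\<lambda>m. s m - s 0 + s 0)"
    by (intro convergent_add convergent_const)
  then show ?thesis by simp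
qed

text \<open>From time \<open>a\<close> on, the orbit splits into \<open>p\<close> subsequences, one
  per residue modulo \<open>p\<close>. If \<open>z\<close> differs from all \<open>p\<close> limits,
  each subsequence eventually keeps a fixed distance from \<open>z\<close>, and so does the whole
  orbit.\<close>

lemma finite_omega_point_if_residues_convergent:
  fixes f :: "'a::metric_space \<Rightarrow> 'a"
  assumes p: "p > 0" and conv: "\<And>r. r < p \<Longrightarrow> convergent (\<lambda>j. (f ^^ (a + r + j * p)) x)"
  shows "finite (omega_point f x)"
proof -
  define L where "L r = lim (\<lambda>j. (f ^^ (a + r + j * p)) x)" for r
  have "z \<in> L ` {..<p}" if z: "z \<in> omega_point f x" for z
  proof (rule ccontr)
    assume nz: "z \<notin> L ` {..<p}"
    define e where "e = Min ((\<lambda>r. dist (L r) z) ` {..<p})"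
    have "e > 0"
      using nz p unfolding e_def by (subst Min_gr_iff) auto
    have "\<forall>r\<in>{..<p}. \<forall>\<^sub>F j in sequentially. dist ((f ^^ (a + r + j * p)) x) (L r) < e / 2"
    proof
      fix r assume "r \<in> {..<p}"
      then have "(\<lambda>j. (f ^^ (a + r + j * p)) x) \<longlonglongrightarrow> L r"
        unfolding L_def by (intro convergent_LIMSEQ_iff[THEN iffD1] conv) simp
      then show "\<forall>\<^sub>F j in sequentially. dist ((f ^^ (a + r + j * p)) x) (L r) < e / 2"
        by (rule tendstoD) (use \<open>e > 0\<close> in simp)
    qed
    then have "\<forall>\<^sub>F j in sequentially. \<forall>r\<in>{..<p}. dist ((f ^^ (a + r + j * p)) x) (L r) < e / 2"
      by (rule eventually_ball_finite[OF finite_lessThan])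
    then obtain N where N: "\<And>j r. j \<ge> N \<Longrightarrow> r < p \<Longrightarrow> dist ((f ^^ (a + r + j * p)) x) (L r) < e / 2"
      unfolding eventually_sequentially by blast
    obtain k where k: "k \<ge> a + N * p" "dist ((f ^^ k) x) z < e / 2"
      using z \<open>e > 0\<close> unfolding omega_point_iff by (meson half_gt_zero)
    define j r where "j = (k - a) div p" and "r = (k - a) mod p"
    have r: "r < p" and kk: "k = a + r + j * p"
      using p k(1) by (auto simp: j_def r_def)
    have "j \<ge> N"
      unfolding j_def using p k(1) by (simp add: less_eq_div_iff_mult_less_eq)
    then have "dist (L r) z < e"
      using N[OF \<open>j \<ge> N\<close> r] k(2) dist_triangle3[of "L r" z "(f ^^ k) x"] by (simp add: kk)
    moreover have "e \<le> dist (L r) z"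
      unfolding e_def using r by (intro Min_le) auto
    ultimately show False by simp
  qed
  then show ?thesis
    by (meson finite_imageI finite_lessThan finite_subset subsetI)
qed

text \<open>Equal codes persist, so points with equal codes have asymptotic orbits and the same
  limit set, and one representative per code suffices. A single limit set is finite because a
  repeated code makes the orbit asymptotic to a shift of itself.\<close>

lemma finite_attractor_if_finite_coding:
  fixes f :: "'a::banach \<Rightarrow> 'a" and c :: "'a \<Rightarrow> 'c"
  assumes inv: "\<And>y. y \<in> X \<Longrightarrow> f y \<in> X"
    and fin: "finite (c ` X)"
    and \<mu>: "0 \<le> \<mu>" "\<mu> < 1"
    and code: "\<And>y z. y \<in> X \<Longrightarrow> z \<in> X \<Longrightarrow> c y = c z \<Longrightarrow> c (f y) = c (f z)"
    and contr: "\<And>y z. y \<in> X \<Longrightarrow> z \<in> X \<Longrightarrow> c y = c z \<Longrightarrow> dist (f y) (f z) \<le> \<mu> * dist y z"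
  shows "finite (\<Union>y\<in>X. omega_point f y)"
proof -
  have invk: "(f ^^ k) y \<in> X" if "y \<in> X" for y k
    using that by (induction k) (auto intro: inv)
  have contrk: "c ((f ^^ k) y) = c ((f ^^ k) z) \<and> dist ((f ^^ k) y) ((f ^^ k) z) \<le> \<mu> ^ k * dist y z"
    if "y \<in> X" "z \<in> X" "c y = c z" for y z k
  proof (induction k)
    case (Suc k)
    have "dist (f ((f ^^ k) y)) (f ((f ^^ k) z)) \<le> \<mu> * dist ((f ^^ k) y) ((f ^^ k) z)"
      using Suc that by (intro contr invk) auto
    also have "\<dots> \<le> \<mu> * (\<mu> ^ k * dist y z)"
      using Suc \<mu> by (intro mult_left_mono) auto
    finally have "dist ((f ^^ Suc k) y) ((f ^^ Suc k) z) \<le> \<mu> ^ Suc k * dist y z"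
      by (simp add: mult.assoc)
    moreover have "c ((f ^^ Suc k) y) = c ((f ^^ Suc k) z)"
      using code[OF invk[OF that(1)] invk[OF that(2)] conjunct1[OF Suc]] by simp
    ultimately show ?case by blast
  qed (use that in simp)
  have sub: "omega_point f y \<subseteq> omega_point f z" if "y \<in> X" "z \<in> X" "c y = c z" for y z
  proof (rule omega_point_subset_if_asymptotic)
    have "(\<lambda>k. \<mu> ^ k * dist y z) \<longlonglongrightarrow> 0"
      using \<mu> by (intro tendsto_mult_left_zero LIMSEQ_realpow_zero) auto
    then show "(\<lambda>k. dist ((f ^^ k) y) ((f ^^ k) z)) \<longlonglongrightarrow> 0"
      by (rule tendsto_sandwich[OF _ _ tendsto_const, rotated 2]) (use contrk[OF that] in auto)
  qed
  have fin1: "finite (omega_point f y)" if y: "y \<in> X" for y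
  proof -
    have "finite (range (\<lambda>k. c ((f ^^ k) y)))"
      by (rule finite_subset[OF _ fin]) (use invk[OF y] in auto)
    then have "\<not> inj (\<lambda>k. c ((f ^^ k) y))"
      using finite_imageD infinite_UNIV_nat by blast
    then obtain a b where ab: "a < b" "c ((f ^^ a) y) = c ((f ^^ b) y)"
      unfolding inj_def by (metis linorder_neqE_nat)
    define p where "p = b - a"
    have p: "p > 0" "b = a + p" using ab by (auto simp: p_def)
    show ?thesis
    proof (rule finite_omega_point_if_residues_convergent[OF p(1), where a = a])
      fix r
      let ?d = "dist ((f ^^ b) y) ((f ^^ a) y)"
      show "convergent (\<lambda>j. (f ^^ (a + r + j * p)) y)"
      proof (rule convergent_if_geometric_increments[where \<mu> = "\<mu> ^ p" and C = "\<mu> ^ r * ?d"])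
        fix j
        \<comment> \<open>Both points come from \<open>(f ^^ b) y\<close> and
          \<open>(f ^^ a) y\<close>, whose codes agree, by the same \<open>r + j * p\<close>
          contracting steps. This is where the constant and the ratio \<open>\<mu> ^ p\<close> come
          from.\<close>
        have "(f ^^ (a + r + Suc j * p)) y = (f ^^ (r + j * p)) ((f ^^ b) y)"
          "(f ^^ (a + r + j * p)) y = (f ^^ (r + j * p)) ((f ^^ a) y)"
          unfolding p(2) comp_apply[symmetric, of "f ^^ _" "f ^^ _"] funpow_add[symmetric]
          by (simp_all add: algebra_simps)
        then show "dist ((f ^^ (a + r + Suc j * p)) y) ((f ^^ (a + r + j * p)) y)
            \<le> \<mu> ^ r * ?d * (\<mu> ^ p) ^ j"
          using contrk[OF invk[OF y] invk[OF y] ab(2)[symmetric], of "r + j * p"]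
          by (simp add: power_add mult_ac flip: power_mult)
      qed (use \<mu> p in \<open>auto simp: power_less_one_iff\<close>)
    qed
  qed
  define rep where "rep u = (SOME y. y \<in> X \<and> c y = u)" for u
  have rep: "rep (c y) \<in> X \<and> c (rep (c y)) = c y" if "y \<in> X" for y
    unfolding rep_def by (rule someI[of _ y]) (use that in simp)
  have "(\<Union>y\<in>X. omega_point f y) \<subseteq> (\<Union>u\<in>c ` X. omega_point f (rep u))"
    using sub rep by fastforce
  moreover have "finite (\<Union>u\<in>c ` X. omega_point f (rep u))"
    by (intro finite_UN_I fin) (use fin1 rep in auto)
  ultimately show ?thesis
    by (rule finite_subset)
qed

section \<open>Expansions in base \<open>b\<close> and words of full complexity\<close>

definition horner_value :: "nat \<Rightarrow> nat list \<Rightarrow> nat" where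
  "horner_value b u = foldl (\<lambda>a d. a * b + d) 0 u"

lemma horner_value_snoc [simp]: "horner_value b (u @ [d]) = horner_value b u * b + d"
  by (simp add: horner_value_def)

lemma ex_horner_value:
  assumes "b > 0" "j < b ^ l"
  shows "\<exists>u. length u = l \<and> set u \<subseteq> {0..<b} \<and> horner_value b u = j"
  using assms(2)
proof (induction l arbitrary: j)
  case 0
  then show ?case by (simp add: horner_value_def)
next
  case (Suc l)
  have "j div b < b ^ l"
    using Suc.prems assms(1) by (simp add: less_mult_imp_div_less mult.commute)
  then obtain u where u: "length u = l" "set u \<subseteq> {0..<b}" "horner_value b u = j div b"
    using Suc.IH by blast
  show ?case
    by (rule exI[of _ "u @ [j mod b]"]) (use u assms(1) in auto)
qed

lemma words_shift: "w \<in> words b \<Longrightarrow> (\<lambda>i. w (i + k)) \<in> words b"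
  by (simp add: words_def)

context
  fixes b :: nat and w :: "nat \<Rightarrow> nat"
  assumes b: "b \<ge> 2" and w: "w \<in> words b"
begin

text \<open>The bounds are the terms of a geometric series with sum 1, so one comparison serves both
  for convergence and for the upper bound 1.\<close>

lemma expansion_term_le: "real (w i) / real b ^ (i + 1) \<le> (1 - 1 / b) * (1 / b) ^ i"
proof -
  have "w i + 1 \<le> b"
    using w by (simp add: words_def Suc_le_eq)
  then have "real (w i) \<le> real b - 1"
    by linarith
  then show ?thesis
    using b by (simp add: field_simps)
qed

lemma expansion_bound_sums: "(\<lambda>i. (1 - 1 / real b) * (1 / b) ^ i) sums 1"
  using sums_mult[OF geometric_sums[of "1 / real b"], of "1 - 1 / b"] b by simp

lemma summable_expansion: "summable (\<lambda>i. real (w i) / real b ^ (i + 1))"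
  by (rule summable_comparison_test'[OF sums_summable[OF expansion_bound_sums]])
    (use expansion_term_le in simp)

lemma expansion_value_nonneg: "0 \<le> expansion_value b w"
  unfolding expansion_value_def by (rule suminf_nonneg[OF summable_expansion]) simp

lemma expansion_value_le_1: "expansion_value b w \<le> 1"
  unfolding expansion_value_def
  using suminf_le[OF expansion_term_le summable_expansion sums_summable[OF expansion_bound_sums]]
    sums_unique[OF expansion_bound_sums] by simp

lemma expansion_value_rec: "b * expansion_value b w = w 0 + expansion_value b (\<lambda>i. w (i + 1))"
proof -
  have "expansion_value b w
      = (\<Sum>i. real (w (Suc i)) / real b ^ (Suc i + 1)) + real (w 0) / b"
    unfolding expansion_value_def using suminf_split_head[OF summable_expansion] by simp
  moreover have "real b * (\<Sum>i. real (w (Suc i)) / real b ^ (Suc i + 1))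
      = (\<Sum>i. real b * (real (w (Suc i)) / real b ^ (Suc i + 1)))"
    by (rule suminf_mult[symmetric]) (rule summable_Suc_iff[THEN iffD2, OF summable_expansion])
  moreover have "\<dots> = expansion_value b (\<lambda>i. w (i + 1))"
    unfolding expansion_value_def using b by (intro suminf_cong) simp
  ultimately show ?thesis
    using b by (simp add: distrib_left)
qed

end

text \<open>Multiplication by \<open>b ^ k\<close> moves the first \<open>k\<close> digits in front
  of the point. The remaining tail can have the value 1, so it need not be the fractional
  part.\<close>

lemma expansion_value_shift:
  assumes "b \<ge> 2" "w \<in> words b"
  shows "real b ^ k * expansion_value b w
    = horner_value b (map w [0..<k]) + expansion_value b (\<lambda>i. w (i + k))"
proof (induction k)
  case 0
  then show ?case by (simp add: horner_value_def)
next
  case (Suc k)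
  have "real b ^ Suc k * expansion_value b w
      = b * horner_value b (map w [0..<k]) + b * expansion_value b (\<lambda>i. w (i + k))"
    using Suc by (simp add: mult.assoc distrib_left)
  also have "b * expansion_value b (\<lambda>i. w (i + k)) = w k + expansion_value b (\<lambda>i. w (i + Suc k))"
    using expansion_value_rec[OF assms(1) words_shift[OF assms(2), of k]] by simp
  finally show ?case
    by (simp add: mult.commute)
qed

text \<open>There are only \<open>b ^ l\<close> blocks of length \<open>l\<close>, so all of them
  occur, in particular the base \<open>b\<close> numeral of \<open>j\<close> padded to length
  \<open>l\<close>. A tail that starts with this block has its value in the cell of index
  \<open>j\<close>; the cell is closed because all later digits may be \<open>b - 1\<close>.\<close>

lemma full_complexity_cylinder:
  fixes j :: nat
  assumes b: "b \<ge> 2" and w: "w \<in> words b" and full: "complexity w l = b ^ l" and j: "j < b ^ l"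
  shows "\<exists>k. expansion_value b (\<lambda>i. w (i + k)) \<in> {j / real b ^ l .. (real j + 1) / real b ^ l}"
proof -
  let ?A = "{u. set u \<subseteq> {0..<b} \<and> length u = l}"
  have "factors l w \<subseteq> ?A"
    using w by (auto simp: factors_def words_def)
  moreover have "finite ?A" "card ?A = b ^ l"
    by (simp_all add: finite_lists_length_eq card_lists_length_eq)
  ultimately have "factors l w = ?A"
    using full by (intro card_subset_eq) (simp_all add: complexity_def)
  moreover obtain u where u: "u \<in> ?A" "horner_value b u = j"
    using ex_horner_value[OF _ j] b by auto
  ultimately have "u \<in> factors l w" by simp
  then obtain k where k: "u = map w [k..<k + l]"
    by (auto simp: factors_def)
  define v where "v = (\<lambda>i. w (i + k))"
  have v: "v \<in> words b"
    unfolding v_def by (rule words_shift[OF w])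
  have "u = map v [0..<l]"
    unfolding k v_def by (intro nth_equalityI) (auto simp: add.commute)
  then have "real b ^ l * expansion_value b v = j + expansion_value b (\<lambda>i. v (i + l))"
    using expansion_value_shift[OF b v, of l] u by simp
  moreover have "expansion_value b (\<lambda>i. v (i + l)) \<in> {0..1}"
    using expansion_value_nonneg expansion_value_le_1 b words_shift[OF v] by simp
  ultimately have "expansion_value b v \<in> {j / real b ^ l .. (real j + 1) / real b ^ l}"
    using b by (auto simp: field_simps)
  then show ?thesis
    unfolding v_def by blast
qed

section \<open>Counting grid cells that meet given intervals, and the choice of
  \<open>ell'\<close>\<close>

lemma card_nat_in_real_interval_le:
  fixes a b :: real
  assumes "a \<le> b + 1"
  shows "finite {j::nat. a \<le> j \<and> j \<le> b}" "card {j::nat. a \<le> j \<and> j \<le> b} \<le> b - a + 1"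
proof -
  have sub: "int ` {j::nat. a \<le> j \<and> j \<le> b} \<subseteq> {\<lceil>a\<rceil>..\<lfloor>b\<rfloor>}"
    by (auto simp: ceiling_le_iff le_floor_iff)
  then show "finite {j::nat. a \<le> j \<and> j \<le> b}"
    by (meson finite_atLeastAtMost_int finite_imageD finite_subset inj_on_of_nat)
  have "card {j::nat. a \<le> j \<and> j \<le> b} \<le> card {\<lceil>a\<rceil>..\<lfloor>b\<rfloor>}"
    using card_mono[OF _ sub] by (simp add: card_image)
  also have "real \<dots> \<le> b - a + 1"
  \<comment> \<open>In the first case the difference formula is exact, even for an empty range with
    \<open>\<lceil>a\<rceil> = \<lfloor>b\<rfloor> + 1\<close>. In the second the count is 0, and
    \<open>a \<le> b + 1\<close> makes the bound nonnegative.\<close>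
  proof (cases "\<lceil>a\<rceil> \<le> \<lfloor>b\<rfloor> + 1")
    case True
    then have "real (card {\<lceil>a\<rceil>..\<lfloor>b\<rfloor>}) = of_int \<lfloor>b\<rfloor> - of_int \<lceil>a\<rceil> + 1"
      by simp
    also have "\<dots> \<le> b - a + 1"
      using of_int_floor_le[of b] le_of_int_ceiling[of a] by linarith
    finally show ?thesis .
  qed (use assms in simp)
  finally show "card {j::nat. a \<le> j \<and> j \<le> b} \<le> b - a + 1" by simp
qed

text \<open>An interval of length L meets at most \<open>N\<close> L + 2 closed cells of width 1 /
  \<open>N\<close>; if these counts add up to less than \<open>M\<close>, one of the first
  \<open>M\<close> cells is missed. Keeping \<open>M\<close> apart from \<open>N\<close> allows
  cells at the right end to be left out.\<close>

lemma ex_grid_cell_avoiding_intervals: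
  fixes a b :: "'i \<Rightarrow> real" and N M :: nat
  assumes "finite I" "N > 0" "\<And>i. i \<in> I \<Longrightarrow> a i \<le> b i"
    and less: "N * (\<Sum>i\<in>I. b i - a i) + 2 * card I < M"
  shows "\<exists>j<M. \<forall>i\<in>I. {j / real N .. (real j + 1) / real N} \<inter> {a i..b i} = {}"
proof (rule ccontr)
  \<comment> \<open>The bounds restate that the cell of index \<open>j\<close> neither starts after
    \<open>b i\<close> nor ends before \<open>a i\<close>. They leave a range of length
    \<open>N * (b i - a i) + 1\<close> for \<open>j\<close>, hence the 2 in the count.\<close>
  define B where "B i = {j::nat. N * a i - 1 \<le> j \<and> j \<le> N * b i}" for i
  assume neg: "\<not> ?thesis"
  have "j \<in> (\<Union>i\<in>I. B i)" if jM: "j < M" for j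
  proof -
    obtain i where "i \<in> I" and "{j / real N .. (real j + 1) / real N} \<inter> {a i..b i} \<noteq> {}"
      using neg jM by blast
    then obtain t where "t \<in> {j / real N .. (real j + 1) / real N}" "t \<in> {a i..b i}"
      by blast
    then have "j / real N \<le> b i" "a i \<le> (real j + 1) / real N"
      by auto
    then have "j \<in> B i"
      using \<open>N > 0\<close> by (simp add: B_def field_simps)
    with \<open>i \<in> I\<close> show ?thesis by blast
  qed
  then have sub: "{..<M} \<subseteq> (\<Union>i\<in>I. B i)" by auto
  have B: "finite (B i)" "card (B i) \<le> N * (b i - a i) + 2" if "i \<in> I" for i
  proof -
    have "N * a i \<le> N * b i"
      using assms(3)[OF that] by (simp add: mult_left_mono)
    then show "finite (B i)" "card (B i) \<le> N * (b i - a i) + 2"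
      using card_nat_in_real_interval_le[of "N * a i - 1" "N * b i"]
      by (simp_all add: B_def right_diff_distrib)
  qed
  have "M \<le> card (\<Union>i\<in>I. B i)"
    using card_mono[OF _ sub] B(1) assms(1) by simp
  also have "\<dots> \<le> (\<Sum>i\<in>I. card (B i))"
    by (rule card_UN_le[OF assms(1)])
  finally have "real M \<le> (\<Sum>i\<in>I. real (card (B i)))"
    by (metis of_nat_le_iff of_nat_sum)
  also have "\<dots> \<le> (\<Sum>i\<in>I. N * (b i - a i) + 2)"
    by (intro sum_mono B)
  also have "\<dots> = N * (\<Sum>i\<in>I. b i - a i) + 2 * card I"
    by (simp add: sum.distrib sum_distrib_left)
  finally show False using less by simp
qed

lemma ell'_less:
  assumes "\<beta> \<ge> 2"
  shows "2 / real \<beta> ^ (2 * ell' \<beta> n) < (1 - 1 / real \<beta>) / real (n + 1)"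
  unfolding ell'_def
proof (rule LeastI_ex)
  have "(1 - 1 / real \<beta>) / real (n + 1) / 2 > 0"
    using assms by simp
  moreover have "1 / real \<beta> ^ 2 < 1"
    using assms by simp
  ultimately obtain k where k: "(1 / real \<beta> ^ 2) ^ k < (1 - 1 / real \<beta>) / real (n + 1) / 2"
    using real_arch_pow_inv \<open>1 / real \<beta> ^ 2 < 1\<close> by blast
  show "\<exists>k. 2 / real \<beta> ^ (2 * k) < (1 - 1 / real \<beta>) / real (n + 1)"
    by (rule exI[of _ k]) (use k in \<open>simp add: power_divide field_simps flip: power_mult\<close>)
qed

section \<open>The piecewise contraction and its iterates modulo 1\<close>

locale piecewise_contraction =
  fixes \<beta> n :: nat and x :: "nat \<Rightarrow> real" and \<alpha> :: "nat \<Rightarrow> nat" and f :: "real \<Rightarrow> real"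
  assumes \<beta>: "\<beta> \<ge> 2" and x_0: "x 0 = 0" and x_n: "x n = 1"
    and x_mono: "strict_mono_on {0..n} x"
    and \<alpha>: "\<And>i. i \<in> {1..n} \<Longrightarrow> \<alpha> i \<in> {1..\<beta>}" and \<alpha>_1: "\<alpha> 1 \<noteq> \<beta>"
    and f_eq: "\<And>i y. i \<in> {1..n} \<Longrightarrow> y \<in> {x (i-1)..<x i} \<Longrightarrow>
           f y = - (1 / real \<beta>) * y + real (\<alpha> i) / real \<beta>"
begin

abbreviation I :: "real set" where "I \<equiv> {0..<1}"

definition preorbit :: "real \<Rightarrow> real set" where
  "preorbit d = {y \<in> I. \<exists>k. (f ^^ k) y = d}"

lemma x_less: "i < j \<Longrightarrow> j \<le> n \<Longrightarrow> x i < x j"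
  using x_mono by (auto simp: strict_mono_on_def)

lemma ex_piece:
  assumes "y \<in> I"
  obtains i where "i \<in> {1..n}" "y \<in> {x (i-1)..<x i}"
proof -
  define i where "i = (LEAST i. y < x i)"
  have n: "y < x n" using assms x_n by simp
  have "y < x i" "i \<le> n"
    unfolding i_def by (rule LeastI[of _ n], rule n) (rule Least_le, rule n)
  moreover have "i \<noteq> 0"
    using \<open>y < x i\<close> assms x_0 by (intro notI) simp
  moreover have "\<not> y < x (i - 1)"
    using \<open>i \<noteq> 0\<close> unfolding i_def by (intro not_less_Least) simp
  ultimately show thesis
    by (intro that[of i]) auto
qed

lemma f_in_I:
  assumes "y \<in> I"
  shows "f y \<in> I"
proof -
  obtain i where i: "i \<in> {1..n}" "y \<in> {x (i-1)..<x i}"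
    using ex_piece[OF assms] .
  \<comment> \<open>The value 1 could arise only from \<open>\<alpha> i = \<beta>\<close> at
    \<open>y = 0\<close>. The point 0 lies in the first piece, where \<open>\<alpha>_1\<close>
    excludes this.\<close>
  have "real (\<alpha> i) - y < \<beta>"
  proof (cases "i = 1")
    case True
    then show ?thesis using \<alpha>[OF i(1)] \<alpha>_1 assms by auto
  next
    case False
    then have "x 0 < x (i - 1)" using i(1) by (intro x_less) auto
    then have "0 < y" using i(2) x_0 by simp
    then show ?thesis using \<alpha>[OF i(1)] by auto
  qed
  moreover have "f y = (\<alpha> i - y) / \<beta>"
    using f_eq[OF i] by (simp add: diff_divide_distrib)
  ultimately show ?thesis
    using \<alpha>[OF i(1)] assms \<beta> by simp
qed

lemma funpow_in_I: "y \<in> I \<Longrightarrow> (f ^^ k) y \<in> I"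
  by (induction k) (use f_in_I in auto)

text \<open>One step gives \<open>- \<beta> * f u = u - \<alpha> i\<close>, and the integer error
  stays an integer under multiplication by powers of \<open>- \<beta>\<close>.\<close>

lemma funpow_recover:
  assumes "y \<in> I"
  shows "(- real \<beta>) ^ k * (f ^^ k) y - y \<in> \<int>"
proof (induction k)
  case (Suc k)
  let ?u = "(f ^^ k) y"
  obtain i where i: "i \<in> {1..n}" "?u \<in> {x (i-1)..<x i}"
    using ex_piece[OF funpow_in_I[OF assms]] .
  have "- real \<beta> * f ?u = ?u - \<alpha> i"
    using f_eq[OF i] \<beta> by (simp add: field_simps)
  then have eq: "(- real \<beta>) ^ Suc k * (f ^^ Suc k) y - y
      = ((- real \<beta>) ^ k * ?u - y) - (- real \<beta>) ^ k * \<alpha> i"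
    by (simp add: algebra_simps)
  moreover have "(- real \<beta>) ^ k * \<alpha> i \<in> \<int>"
    by (intro Ints_mult Ints_power Ints_minus Ints_of_nat)
  ultimately show ?case
    unfolding eq by (intro Ints_diff Suc)
qed simp

lemma eq_frac_funpow: "y \<in> I \<Longrightarrow> y = frac ((- real \<beta>) ^ k * (f ^^ k) y)"
  using funpow_recover[of y k] by (intro sym[OF iffD2[OF frac_unique_iff]]) auto

section \<open>Finiteness of backward orbits\<close>

lemma finite_preorbit_rational:
  assumes "d \<in> \<rat>"
  shows "finite (preorbit d)"
proof -
  obtain m :: int and q :: nat where q: "q > 0" "d = m / q"
    using assms unfolding Rats_eq_int_div_nat by auto
  have "preorbit d \<subseteq> (\<lambda>t. real_of_int t / q) ` {0..<int q}"
  proof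
    fix y assume "y \<in> preorbit d"
    then obtain k where y: "y \<in> I" and k: "(f ^^ k) y = d"
      by (auto simp: preorbit_def)
    obtain m' :: int where m': "(- real \<beta>) ^ k * d - y = m'"
      using funpow_recover[OF y, of k] k by (auto elim: Ints_cases)
    \<comment> \<open>The denominator \<open>q\<close> of \<open>d\<close> works for every
      \<open>k\<close> at once: \<open>q * y\<close> is an integer in
      \<open>{0..<q}\<close>.\<close>
    have "real q * y = q * ((- real \<beta>) ^ k * d) - q * m'"
      using m' by (simp add: algebra_simps flip: m')
    also have "q * ((- real \<beta>) ^ k * d) = (- real \<beta>) ^ k * m"
      using q by simp
    finally have t: "real q * y = real_of_int ((- int \<beta>) ^ k * m - q * m')" (is "_ = real_of_int ?t")
      by simp
    have "0 \<le> real q * y" "real q * y < real_of_int (int q)"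
      using y q by auto
    then have "?t \<in> {0..<int q}"
      unfolding t of_int_0_le_iff of_int_less_iff by simp
    moreover have "y = real_of_int ?t / q"
      unfolding t[symmetric] using q(1) by simp
    ultimately show "y \<in> (\<lambda>t. real_of_int t / q) ` {0..<int q}" by blast
  qed
  then show ?thesis
    by (rule finite_subset) simp
qed

text \<open>The slope is negative, so the endpoints of each piece trade places. The intervals are
  closed to fit the counting of grid cells.\<close>

lemma f_image_subset: "f ` I \<subseteq> (\<Union>i\<in>{1..n}. {(\<alpha> i - x i) / \<beta> .. (\<alpha> i - x (i - 1)) / \<beta>})"
proof (rule image_subsetI)
  fix y assume "y \<in> I"
  then obtain i where i: "i \<in> {1..n}" "y \<in> {x (i-1)..<x i}"
    using ex_piece by blast
  then have "f y = (\<alpha> i - y) / \<beta>"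
    using f_eq[OF i] by (simp add: diff_divide_distrib)
  then have "f y \<in> {(\<alpha> i - x i) / \<beta> .. (\<alpha> i - x (i - 1)) / \<beta>}"
    using i(2) by (auto intro: divide_right_mono)
  with i(1) show "f y \<in> (\<Union>i\<in>{1..n}. {(\<alpha> i - x i) / \<beta> .. (\<alpha> i - x (i - 1)) / \<beta>})" by blast
qed

lemma ex_cylinder_outside_image:
  defines "N \<equiv> \<beta> ^ (2 * ell' \<beta> n)"
  shows "\<exists>j::nat. j + 1 < N \<and> {j / real N .. (real j + 1) / real N} \<inter> f ` I = {}"
proof -
  have N: "N > 0" using \<beta> by (simp add: N_def)
  have "(\<Sum>i\<in>{1..n}. (\<alpha> i - x (i - 1)) / \<beta> - (\<alpha> i - x i) / \<beta>)
      = (\<Sum>i\<in>{1..n}. x i - x (i - 1)) / \<beta>"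
    by (simp add: sum_divide_distrib flip: diff_divide_distrib)
  also have "(\<Sum>i\<in>{1..n}. x i - x (i - 1)) = 1"
    using sum_telescope''[of 0 n x] x_0 x_n by (simp add: atLeast0AtMost)
  finally have len: "(\<Sum>i\<in>{1..n}. (\<alpha> i - x (i - 1)) / \<beta> - (\<alpha> i - x i) / \<beta>) = 1 / \<beta>" .
  have "2 / real N < (1 - 1 / real \<beta>) / real (n + 1)"
    using ell'_less[OF \<beta>, of n] by (simp add: N_def)
  then have "2 * real (n + 1) < N * (1 - 1 / real \<beta>)"
    using N by (simp add: divide_less_eq less_divide_eq mult.commute)
  \<comment> \<open>The \<open>n\<close> intervals meet at most \<open>N / \<beta> + 2 * n\<close>
    cells. The factor \<open>n + 1\<close> in the definition of \<open>ell'\<close> leaves a surplus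
    of 2, which covers the removal of the last cell.\<close>
  then have less: "N * (1 / real \<beta>) + 2 * n + 2 < N"
    by (simp add: algebra_simps)
  moreover have "N * (1 / real \<beta>) \<ge> 0" by simp
  ultimately have "real (N - 1) = N - 1"
    using N by simp
  \<comment> \<open>Excluding the last cell keeps the closed cell away from \<open>1\<close>, so that an expansion value in it
    is a fractional part.\<close>
  then have "\<exists>j<N - 1. \<forall>i\<in>{1..n}. {j / real N .. (real j + 1) / real N}
      \<inter> {(\<alpha> i - x i) / \<beta> .. (\<alpha> i - x (i - 1)) / \<beta>} = {}"
  proof (intro ex_grid_cell_avoiding_intervals)
    show "(\<alpha> i - x i) / \<beta> \<le> (\<alpha> i - x (i - 1)) / \<beta>" if "i \<in> {1..n}" for i
      using x_less[of "i - 1" i] that by (intro divide_right_mono) auto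
  qed (use N less len in auto)
  then obtain j where "j < N - 1" and j: "\<And>i. i \<in> {1..n} \<Longrightarrow> {j / real N .. (real j + 1) / real N}
      \<inter> {(\<alpha> i - x i) / \<beta> .. (\<alpha> i - x (i - 1)) / \<beta>} = {}"
    by blast
  have "{j / real N .. (real j + 1) / real N}
      \<inter> (\<Union>i\<in>{1..n}. {(\<alpha> i - x i) / \<beta> .. (\<alpha> i - x (i - 1)) / \<beta>}) = {}"
    unfolding Int_UN_distrib by (intro equalityI UN_least empty_subsetI equalityD1[OF j])
  then have "{j / real N .. (real j + 1) / real N} \<inter> f ` I \<subseteq> {}"
    by (rule order_trans[OF Int_mono[OF order_refl f_image_subset] equalityD1])
  moreover have "j + 1 < N"
    using \<open>j < N - 1\<close> by simp
  ultimately show ?thesis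
    by (intro exI[of _ j] conjI) (simp_all only: subset_empty)
qed

text \<open>Some tail \<open>e s\<close> of the expansion lies in a cell that \<open>f\<close>
  misses. It agrees with \<open>(- \<beta>) ^ (2 * s) * d\<close> modulo 1, so it is the only
  candidate in \<open>I\<close> for a preimage of \<open>d\<close> under
  \<open>f ^^ (2 * s)\<close>, and it is not itself a value of \<open>f\<close>. Hence only
  \<open>k \<le> 2 * s\<close> occur, with at most one point for each \<open>k\<close>.\<close>

lemma finite_preorbit_S':
  assumes "d \<in> S' \<beta> n"
  shows "finite (preorbit d)"
proof -
  define N where "N = \<beta> ^ (2 * ell' \<beta> n)"
  have N: "N = (\<beta>\<^sup>2) ^ ell' \<beta> n" "N > 0"
    using \<beta> by (simp_all add: N_def power_mult)
  have b: "\<beta>\<^sup>2 \<ge> 2"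
    using \<beta> self_le_power[of \<beta> 2] by linarith
  obtain w where w: "w \<in> words (\<beta>\<^sup>2)" and d: "d = expansion_value (\<beta>\<^sup>2) w"
    and full: "complexity w (ell' \<beta> n) = N"
    using assms by (auto simp: S'_def N_def)
  obtain j where j: "j + 1 < N" "{j / real N .. (real j + 1) / real N} \<inter> f ` I = {}"
    using ex_cylinder_outside_image unfolding N_def[symmetric] by (elim exE conjE)
  define e where "e s = expansion_value (\<beta>\<^sup>2) (\<lambda>i. w (i + s))" for s
  obtain s where s: "e s \<in> {j / real N .. (real j + 1) / real N}"
    using full_complexity_cylinder[OF b w full[unfolded N(1)], of j] j(1)
    unfolding e_def N(1) of_nat_power by auto
  have "(real j + 1) / real N < 1"
    using j(1) N(2) by simp
  moreover have "0 \<le> e s"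
    using expansion_value_nonneg[OF b words_shift[OF w]] by (simp add: e_def)
  ultimately have e_I: "e s \<in> I"
    using s by simp
  have "real (\<beta>\<^sup>2) ^ s * d = horner_value (\<beta>\<^sup>2) (map w [0..<s]) + e s"
    unfolding d e_def by (rule expansion_value_shift[OF b w])
  \<comment> \<open>Here the base \<open>\<beta>\<^sup>2\<close> matters: an even power of
    \<open>- \<beta>\<close> has no sign, so a shift of the word by \<open>s\<close> corresponds to
    \<open>2 * s\<close> backward steps.\<close>
  then have shift: "(- real \<beta>) ^ (2 * s) * d - e s \<in> \<int>"
    by (simp add: power_mult)
  have bound: "k \<le> 2 * s" if y: "y \<in> I" and k: "(f ^^ k) y = d" for y k
  proof (rule ccontr)
    assume "\<not> k \<le> 2 * s"
    then obtain m where m: "k = 2 * s + Suc m"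
      by (metis add_Suc_right less_iff_Suc_add not_le)
    \<comment> \<open>At least one application of \<open>f\<close> separates \<open>u\<close> from
      \<open>y\<close>, which puts \<open>u\<close> in the image of \<open>f\<close>.\<close>
    define u where "u = (f ^^ Suc m) y"
    have "u \<in> f ` I"
      unfolding u_def using funpow_in_I[OF y, of m] by simp
    moreover have "(f ^^ (2 * s)) u = d"
      using k unfolding u_def m funpow_add by simp
    then have "u = frac ((- real \<beta>) ^ (2 * s) * d)"
      using eq_frac_funpow[of u "2 * s"] funpow_in_I[OF y, of "Suc m"] by (simp add: u_def)
    then have "u = e s"
      using iffD2[OF frac_unique_iff, of _ "e s"] shift e_I by simp
    ultimately have "e s \<in> f ` I"
      by (simp only:)
    with s have "e s \<in> {j / real N .. (real j + 1) / real N} \<inter> f ` I"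
      by (rule IntI)
    then show False
      unfolding j(2) by (rule emptyE)
  qed
  have "preorbit d \<subseteq> (\<lambda>k. frac ((- real \<beta>) ^ k * d)) ` {..2 * s}"
  proof
    fix y assume "y \<in> preorbit d"
    then obtain k where k: "y \<in> I" "(f ^^ k) y = d"
      unfolding preorbit_def by blast
    have "y = frac ((- real \<beta>) ^ k * d)"
      using eq_frac_funpow[OF k(1), of k] unfolding k(2) .
    then show "y \<in> (\<lambda>k. frac ((- real \<beta>) ^ k * d)) ` {..2 * s}"
      by (rule image_eqI) (use bound[OF k] in simp)
  qed
  then show ?thesis
    by (rule finite_subset) simp
qed

section \<open>Coding points by their position among the backward orbits\<close>

lemma finite_attractor_if_finite_preorbits:
  assumes fin: "\<And>i. i \<in> {1..n-1} \<Longrightarrow> finite (preorbit (x i))"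
  shows "finite (global_attractor f)"
proof -
  define Q where "Q = (\<Union>i\<in>{1..n-1}. preorbit (x i))"
  \<comment> \<open>The two sets together separate a point of \<open>Q\<close> from the gaps on
    either side of it. Thus distinct points with equal codes have no point of \<open>Q\<close> on
    the closed segment between them.\<close>
  define c where "c y = ({q \<in> Q. q < y}, {q \<in> Q. q \<le> y})" for y
  have finQ: "finite Q"
    using fin by (auto simp: Q_def)
  have f_Q: "y \<in> Q" if "y \<in> I" and fy: "f y \<in> Q" for y
  proof -
    obtain i k where i: "i \<in> {1..n-1}" and k: "(f ^^ k) (f y) = x i"
      using fy unfolding Q_def preorbit_def by blast
    have "(f ^^ Suc k) y = x i"
      using k by (simp only: funpow_Suc_right comp_apply)
    then show ?thesis
      using i \<open>y \<in> I\<close> unfolding Q_def preorbit_def by blast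
  qed
  have x_Q: "x i \<in> Q" if "i \<in> {1..n-1}" for i
  proof -
    have "0 < i" "i < n" using that by auto
    then have "x i \<in> I"
      using x_less[of 0 i] x_less[of i n] x_0 x_n by (simp add: less_imp_le)
    moreover have "(f ^^ 0) (x i) = x i" by simp
    ultimately have "x i \<in> preorbit (x i)"
      unfolding preorbit_def by blast
    with that show ?thesis
      unfolding Q_def by (rule UN_I)
  qed
  have key: "c (f y) = c (f z) \<and> dist (f y) (f z) \<le> 1 / \<beta> * dist y z"
    if "y \<in> I" "z \<in> I" "c y = c z" "y < z" for y z
  proof -
    have gap: "u \<notin> Q" if "y \<le> u" "u \<le> z" for u
    proof
      assume "u \<in> Q"
      then have "u < y \<longleftrightarrow> u < z" "u \<le> y \<longleftrightarrow> u \<le> z"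
        using \<open>c y = c z\<close> unfolding c_def prod.inject set_eq_iff by blast+
      then show False
        using that \<open>y < z\<close> by linarith
    qed
    obtain i where i: "i \<in> {1..n}" "y \<in> {x (i-1)..<x i}"
      using ex_piece \<open>y \<in> I\<close> by blast
    \<comment> \<open>This puts \<open>y\<close> and \<open>z\<close> in the same piece: inner
      breakpoints belong to \<open>Q\<close> and cannot separate them, and \<open>x n = 1\<close>
      lies above \<open>z\<close> anyway.\<close>
    have zi: "z < x i"
    proof (cases "i = n")
      case False
      then have "x i \<in> Q" using i(1) by (intro x_Q) auto
      then show ?thesis using gap[of "x i"] i(2) by force
    qed (use \<open>z \<in> I\<close> x_n in simp)
    have f: "f t = (real (\<alpha> i) - t) / \<beta>" if "y \<le> t" "t \<le> z" for t
      using f_eq[OF i(1), of t] i(2) zi that by (simp add: diff_divide_distrib)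
    \<comment> \<open>The affine branch maps the segment from \<open>y\<close> to \<open>z\<close>
      onto the one from \<open>f z\<close> to \<open>f y\<close>, and \<open>t'\<close> is the
      preimage of \<open>t\<close> on it. By \<open>f_Q\<close>, a point \<open>t\<close> of
      \<open>Q\<close> would force \<open>t'\<close> into \<open>Q\<close>, against
      \<open>gap\<close>.\<close>
    have f_gap: "t \<notin> Q" if "f z \<le> t" "t \<le> f y" for t
    proof -
      define t' where "t' = real (\<alpha> i) - \<beta> * t"
      have t': "y \<le> t'" "t' \<le> z"
        using that f[of y] f[of z] \<open>y < z\<close> \<beta> by (simp_all add: t'_def field_simps)
      have "f t' = t"
        using f[OF t'] \<beta> by (simp add: t'_def)
      then show ?thesis
        using f_Q[of t'] gap[OF t'] t' \<open>y \<in> I\<close> \<open>z \<in> I\<close> by auto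
    qed
    have "f z \<le> f y"
      using f[of y] f[of z] \<open>y < z\<close> by (simp add: divide_right_mono)
    then have "q < f y \<longleftrightarrow> q < f z" "q \<le> f y \<longleftrightarrow> q \<le> f z" if "q \<in> Q" for q
      using f_gap[of q] that by linarith+
    then have "c (f y) = c (f z)"
      unfolding c_def by blast
    moreover have "dist (f y) (f z) = 1 / \<beta> * dist y z"
      using f[of y] f[of z] \<open>y < z\<close>
      by (simp add: dist_real_def abs_divide flip: diff_divide_distrib)
    ultimately show ?thesis by simp
  qed
  have code: "c (f y) = c (f z) \<and> dist (f y) (f z) \<le> 1 / \<beta> * dist y z"
    if "y \<in> I" "z \<in> I" "c y = c z" for y z
  proof (cases y z rule: linorder_cases)
    case less
    show ?thesis by (rule key[OF that less])
  next
    case greater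
    show ?thesis
      using key[OF that(2,1) that(3)[symmetric] greater] by (simp add: dist_commute)
  qed simp
  have "c ` I \<subseteq> Pow Q \<times> Pow Q"
    by (auto simp: c_def)
  then have finc: "finite (c ` I)"
    by (rule finite_subset) (use finQ in simp)
  show ?thesis
    unfolding global_attractor_def
    by (rule finite_attractor_if_finite_coding[OF f_in_I finc _ _
          code[THEN conjunct1] code[THEN conjunct2]]) (use \<beta> in simp_all)
qed

end

theorem theorem2p2:
  fixes \<beta> n :: nat and x :: "nat \<Rightarrow> real" and \<alpha> :: "nat \<Rightarrow> nat" and f :: "real \<Rightarrow> real"
  assumes "\<beta> \<ge> 2" and "n \<ge> 2"
    and "x 0 = 0" and "x n = 1" and "strict_mono_on {0..n} x"
    and "\<And>i. i \<in> {1..n-1} \<Longrightarrow> x i \<in> \<rat> \<or> x i \<in> S' \<beta> n"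
    and "\<And>i. i \<in> {1..n} \<Longrightarrow> \<alpha> i \<in> {1..\<beta>}" and "\<alpha> 1 \<noteq> \<beta>"
    and "\<And>i y. i \<in> {1..n} \<Longrightarrow> y \<in> {x (i-1)..<x i} \<Longrightarrow>
           f y = - (1 / real \<beta>) * y + real (\<alpha> i) / real \<beta>"
  shows "finite (global_attractor f)"
proof -
  interpret piecewise_contraction \<beta> n x \<alpha> f
    using assms by unfold_locales
  show ?thesis
    using assms(6) finite_preorbit_rational finite_preorbit_S'
    by (intro finite_attractor_if_finite_preorbits) blast
qed

end
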